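(* Let $\mathcal{H}$ be a complex Hilbert space, let $T,S$ be $EP$ operators on $\mathcal{H}$ and let $A\in\mathcal{B}(\mathcal{H})$. If $AT=SA$ and $AT^\dagger T^*=S^\dagger S^*A$, then $AT^*=S^*A$.
   Context: $\mathcal{B}(\mathcal{H})$ is the space of bounded linear operators on $\mathcal{H}$; $\mathcal{R}(T)$ denotes the range of $T$ and $T^*$ its adjoint. For $T\in\mathcal{B}(\mathcal{H})$ with closed range, the Moore-Penrose inverse $T^\dagger$ is the unique operator in $\mathcal{B}(\mathcal{H})$ satisfying $TT^\dagger T=T$, $T^\dagger TT^\dagger=T^\dagger$, $TT^\dagger=(TT^\dagger)^*$ and $T^\dagger T=(T^\dagger T)^*$. An $EP$ operator on $\mathcal{H}$ is a $T\in\mathcal{B}(\mathcal{H})$ with closed range such that $\mathcal{R}(T)=\mathcal{R}(T^* )$. *)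

theory Defs
  imports "HOL-Analysis.Analysis"
begin

text \<open>Complex Hilbert spaces. The scalar multiplication by complex numbers extends the real one of
  the underlying Banach space, the inner product is linear in the first and conjugate-linear in the
  second argument, and the norm (hence the topology, and the completeness inherited from
  \<^class>\<open>banach\<close>) is the one induced by the inner product.\<close>

class complex_hilbert_space = banach +
  fixes scaleC :: "complex \<Rightarrow> 'a \<Rightarrow> 'a"  (infixr \<open>*\<^sub>C\<close> 75)
    and cinner :: "'a \<Rightarrow> 'a \<Rightarrow> complex"
  assumes scaleC_add_right: "c *\<^sub>C (x + y) = c *\<^sub>C x + c *\<^sub>C y"
    and scaleC_add_left: "(c + d) *\<^sub>C x = c *\<^sub>C x + d *\<^sub>C x"
    and scaleC_scaleC: "c *\<^sub>C (d *\<^sub>C x) = (c * d) *\<^sub>C x"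
    and scaleC_one: "1 *\<^sub>C x = x"
    and scaleR_scaleC: "r *\<^sub>R x = complex_of_real r *\<^sub>C x"
    and cinner_commute: "cinner x y = cnj (cinner y x)"
    and cinner_add_left: "cinner (x + y) z = cinner x z + cinner y z"
    and cinner_scaleC_left: "cinner (c *\<^sub>C x) y = c * cinner x y"
    and cinner_self_nonneg: "0 \<le> Re (cinner x x)"
    and cinner_self_eq_zero: "cinner x x = 0 \<longleftrightarrow> x = 0"
    and norm_eq_sqrt_cinner: "norm x = sqrt (Re (cinner x x))"

instantiation complex :: complex_hilbert_space
begin

definition scaleC_complex :: "complex \<Rightarrow> complex \<Rightarrow> complex"
  where "scaleC_complex c x = c * x"

definition cinner_complex :: "complex \<Rightarrow> complex \<Rightarrow> complex"
  where "cinner_complex x y = x * cnj y"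

instance
  by standard
    (auto simp: scaleC_complex_def cinner_complex_def algebra_simps scaleR_conv_of_real
      cmod_def power2_eq_square)

end

definition bounded_clinear ::
    "('a::complex_hilbert_space \<Rightarrow> 'b::complex_hilbert_space) \<Rightarrow> bool"
  where "bounded_clinear T \<longleftrightarrow> bounded_linear T \<and> (\<forall>c x. T (c *\<^sub>C x) = c *\<^sub>C T x)"

text \<open>The following two notions are definite descriptions: the adjoint is meaningful for bounded
  operators, the Moore-Penrose inverse for bounded operators with closed range.\<close>

definition cadjoint ::
    "('a::complex_hilbert_space \<Rightarrow> 'b::complex_hilbert_space) \<Rightarrow> 'b \<Rightarrow> 'a"
  where "cadjoint T = (THE T'. \<forall>x y. cinner (T x) y = cinner x (T' y))"

definition is_mp_inverse ::
    "('a::complex_hilbert_space \<Rightarrow> 'a) \<Rightarrow> ('a \<Rightarrow> 'a) \<Rightarrow> bool"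
  where "is_mp_inverse T X \<longleftrightarrow>
    bounded_clinear X \<and>
    T \<circ> X \<circ> T = T \<and>
    X \<circ> T \<circ> X = X \<and>
    T \<circ> X = cadjoint (T \<circ> X) \<and>
    X \<circ> T = cadjoint (X \<circ> T)"

definition mp_inverse :: "('a::complex_hilbert_space \<Rightarrow> 'a) \<Rightarrow> 'a \<Rightarrow> 'a"
  where "mp_inverse T = (THE X. is_mp_inverse T X)"

definition EP_operator :: "('a::complex_hilbert_space \<Rightarrow> 'a) \<Rightarrow> bool"
  where "EP_operator T \<longleftrightarrow>
    bounded_clinear T \<and> closed (range T) \<and> range T = range (cadjoint T)"

end

theory Submission
  imports Defs
begin

text \<open>For an EP operator \<open>T\<close>, the operator \<open>T T\<^sup>\<dagger>\<close> is the identity on the range of \<open>T\<close>, which is also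
  the range of the adjoint, so \<open>T T\<^sup>\<dagger> T\<^sup>* = T\<^sup>*\<close>. Multiplying the second hypothesis by \<open>S\<close> from
  the left and moving \<open>S\<close> past \<open>A\<close> with the first one gives
  \<open>A T\<^sup>* = A T T\<^sup>\<dagger> T\<^sup>* = S A T\<^sup>\<dagger> T\<^sup>* = S S\<^sup>\<dagger> S\<^sup>* A = S\<^sup>* A\<close>.

  The algebra is short; the work lies in showing that the adjoint and the Moore-Penrose inverse,
  both given by definite descriptions, have their defining properties. Adjoints come from the Riesz
  representation theorem, which rests on orthogonal projection onto closed subspaces
  (\<open>orthogonal_projection_exists\<close>, \<open>Riesz_representation\<close>, \<open>cinner_cadjoint\<close>). The Moore-Penrose
  inverse of an EP operator is the inverse of its restriction to its range, extended by zero on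
  the orthogonal complement; that this map is bounded follows from the uniform boundedness
  principle (\<open>uniform_boundedness\<close>, \<open>EP_operator_has_mp_inverse\<close>).\<close>

section \<open>Geometry of complex inner products\<close>

context complex_hilbert_space
begin

lemma cinner_add_right: "cinner x (y + z) = cinner x y + cinner x z"
  by (metis cinner_add_left cinner_commute complex_cnj_add)

lemma cinner_scaleC_right: "cinner x (c *\<^sub>C y) = cnj c * cinner x y"
  by (metis cinner_commute cinner_scaleC_left complex_cnj_mult)

lemma cinner_zero_left [simp]: "cinner 0 x = 0"
  using cinner_add_left[of 0 0 x] by simp

lemma cinner_zero_right [simp]: "cinner x 0 = 0"
  using cinner_add_right[of x 0 0] by simp

lemma cinner_diff_left: "cinner (x - y) z = cinner x z - cinner y z"
  using cinner_add_left[of "x - y" y z] by simp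

lemma cinner_diff_right: "cinner x (y - z) = cinner x y - cinner x z"
  using cinner_add_right[of x "y - z" z] by simp

lemma cinner_self: "cinner x x = complex_of_real ((norm x)\<^sup>2)"
proof -
  have "Im (cinner x x) = 0"
    using arg_cong[OF cinner_commute[of x x], of Im] by simp
  then show ?thesis
    by (simp add: complex_eq_iff norm_eq_sqrt_cinner cinner_self_nonneg)
qed

lemma cinner_zero_commute: "cinner x y = 0 \<longleftrightarrow> cinner y x = 0"
  using cinner_commute[of x y] complex_cnj_zero_iff[of "cinner y x"] by simp

lemma cinner_ext:
  assumes "\<And>z. cinner z x = cinner z y"
  shows "x = y"
proof -
  have "cinner (x - y) (x - y) = 0"
    using assms[of "x - y"] by (simp add: cinner_diff_right)
  then show ?thesis
    by (simp add: cinner_self_eq_zero)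
qed

end

lemma norm_add_orthogonal:
  fixes x y :: "'a::complex_hilbert_space"
  assumes "cinner x y = 0"
  shows "(norm (x + y))\<^sup>2 = (norm x)\<^sup>2 + (norm y)\<^sup>2"
proof -
  have "complex_of_real ((norm (x + y))\<^sup>2) = complex_of_real ((norm x)\<^sup>2 + (norm y)\<^sup>2)"
    using assms cinner_zero_commute[of x y]
    by (simp only: cinner_self[symmetric] of_real_add cinner_add_left cinner_add_right) simp
  then show ?thesis
    by (simp only: of_real_eq_iff)
qed

lemma parallelogram_law_cinner:
  fixes x y :: "'a::complex_hilbert_space"
  shows "(norm (x + y))\<^sup>2 + (norm (x - y))\<^sup>2 = 2 * (norm x)\<^sup>2 + 2 * (norm y)\<^sup>2"
proof -
  have "complex_of_real ((norm (x + y))\<^sup>2 + (norm (x - y))\<^sup>2)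
      = complex_of_real ((norm x)\<^sup>2 + (norm x)\<^sup>2 + ((norm y)\<^sup>2 + (norm y)\<^sup>2))"
    by (simp only: cinner_self[symmetric] of_real_add)
      (simp add: cinner_add_left cinner_add_right cinner_diff_left cinner_diff_right)
  then show ?thesis
    by (simp only: of_real_eq_iff)
qed

text \<open>Splitting off from \<open>u\<close> its component along \<open>n\<close> reduces its squared norm by that of the
  component. This gives both the Cauchy-Schwarz inequality and the orthogonality of a best
  approximation.\<close>

lemma norm_diff_component:
  fixes u n :: "'a::complex_hilbert_space"
  assumes "n \<noteq> 0"
  shows "(norm (u - (cinner u n / cinner n n) *\<^sub>C n))\<^sup>2
    = (norm u)\<^sup>2 - (cmod (cinner u n))\<^sup>2 / (norm n)\<^sup>2"
proof -
  define c where "c = cinner u n / cinner n n"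
  have nn: "cinner n n \<noteq> 0"
    using assms by (simp add: cinner_self_eq_zero)
  have "cinner (u - c *\<^sub>C n) (c *\<^sub>C n) = 0"
    using nn by (simp add: cinner_scaleC_right cinner_diff_left cinner_scaleC_left c_def)
  then have "(norm u)\<^sup>2 = (norm (u - c *\<^sub>C n))\<^sup>2 + (norm (c *\<^sub>C n))\<^sup>2"
    using norm_add_orthogonal by (metis diff_add_cancel)
  moreover have "(norm (c *\<^sub>C n))\<^sup>2 = (cmod (cinner u n))\<^sup>2 / (norm n)\<^sup>2"
  proof -
    have "complex_of_real ((norm (c *\<^sub>C n))\<^sup>2) = c * cnj c * complex_of_real ((norm n)\<^sup>2)"
      by (simp only: cinner_self[symmetric]) (simp add: cinner_scaleC_left cinner_scaleC_right)
    also have "\<dots> = complex_of_real ((cmod c)\<^sup>2 * (norm n)\<^sup>2)"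
      by (metis complex_norm_square of_real_mult)
    finally have "(norm (c *\<^sub>C n))\<^sup>2 = (cmod c)\<^sup>2 * (norm n)\<^sup>2"
      by (simp only: of_real_eq_iff)
    also have "cmod c = cmod (cinner u n) / (norm n)\<^sup>2"
      unfolding c_def cinner_self by (simp only: norm_divide norm_of_real) simp
    finally show ?thesis
      using assms by (simp add: field_simps power2_eq_square)
  qed
  ultimately show ?thesis
    by (simp add: c_def)
qed

lemma cinner_Cauchy_Schwarz:
  fixes x y :: "'a::complex_hilbert_space"
  shows "cmod (cinner x y) \<le> norm x * norm y"
proof (cases "y = 0")
  case False
  then have "(cmod (cinner x y))\<^sup>2 / (norm y)\<^sup>2 \<le> (norm x)\<^sup>2"
    using norm_diff_component[of y x] by (metis diff_ge_0_iff_ge zero_le_power2)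
  then have "(cmod (cinner x y))\<^sup>2 \<le> (norm x * norm y)\<^sup>2"
    using False by (simp add: field_simps)
  then show ?thesis
    by (rule power2_le_imp_le) simp
qed simp

lemma bounded_clinearD:
  assumes "bounded_clinear T"
  shows "bounded_linear T" "T (x + y) = T x + T y" "T (x - y) = T x - T y"
    "T (c *\<^sub>C x) = c *\<^sub>C T x" "T 0 = 0"
  using assms unfolding bounded_clinear_def
  by (auto simp: linear_add linear_diff linear_0 bounded_linear.linear)

lemma bounded_clinearI:
  assumes "\<And>x y. T (x + y) = T x + T y" and "\<And>c x. T (c *\<^sub>C x) = c *\<^sub>C T x"
    and "\<And>x. norm (T x) \<le> norm x * K"
  shows "bounded_clinear T"
  unfolding bounded_clinear_def
  using assms by (auto intro!: bounded_linear_intro[where K = K] simp: scaleR_scaleC)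

lemma bounded_clinear_compose:
  assumes "bounded_clinear S" and "bounded_clinear T"
  shows "bounded_clinear (S \<circ> T)"
  using assms unfolding bounded_clinear_def
  by (auto simp: o_def intro: bounded_linear_compose)

lemma bounded_clinear_cinner_left: "bounded_clinear (\<lambda>x. cinner x y)"
  by (rule bounded_clinearI[where K = "norm y"])
    (auto simp: cinner_add_left cinner_scaleC_left scaleC_complex_def cinner_Cauchy_Schwarz)

section \<open>Orthogonal projection, Riesz representation and adjoints\<close>

definition closed_csubspace :: "'a::complex_hilbert_space set \<Rightarrow> bool"
  where "closed_csubspace M \<longleftrightarrow>
    closed M \<and> M \<noteq> {} \<and> (\<forall>x\<in>M. \<forall>y\<in>M. x + y \<in> M) \<and> (\<forall>c. \<forall>x\<in>M. c *\<^sub>C x \<in> M)"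

lemma closed_csubspaceD:
  assumes "closed_csubspace M"
  shows "closed M" "M \<noteq> {}" "\<And>x y. x \<in> M \<Longrightarrow> y \<in> M \<Longrightarrow> x + y \<in> M"
    "\<And>c x. x \<in> M \<Longrightarrow> c *\<^sub>C x \<in> M"
    "\<And>x y. x \<in> M \<Longrightarrow> y \<in> M \<Longrightarrow> x - y \<in> M"
proof -
  show closure: "closed M" "M \<noteq> {}" "\<And>x y. x \<in> M \<Longrightarrow> y \<in> M \<Longrightarrow> x + y \<in> M"
    "\<And>c x. x \<in> M \<Longrightarrow> c *\<^sub>C x \<in> M"
    using assms unfolding closed_csubspace_def by auto
  fix x y
  assume "x \<in> M" "y \<in> M"
  moreover have "- y = (-1) *\<^sub>C y"
    using scaleR_scaleC[of "-1" y] by simp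
  ultimately show "x - y \<in> M"
    using closure(3,4) by (metis diff_conv_add_uminus)
qed

lemma closed_csubspace_kernel:
  assumes "bounded_clinear T"
  shows "closed_csubspace {x. T x = 0}"
proof -
  have "closed {x. T x = 0}"
    using assms by (intro closed_Collect_eq continuous_intros linear_continuous_on)
      (auto dest: bounded_clinearD(1))
  moreover have "c *\<^sub>C (0::'b) = 0" for c
    using cinner_scaleC_left[of c "0::'b" "c *\<^sub>C 0"] cinner_self_eq_zero[of "c *\<^sub>C (0::'b)"]
    by simp
  ultimately show ?thesis
    using bounded_clinearD[OF assms] unfolding closed_csubspace_def by auto
qed

lemma closed_csubspace_range:
  assumes "bounded_clinear T" and "closed (range T)"
  shows "closed_csubspace (range T)"
proof -
  have "T x + T y \<in> range T" "c *\<^sub>C T x \<in> range T" for c x y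
    using bounded_clinearD[OF assms(1)] by (metis rangeI)+
  then show ?thesis
    using assms(2) unfolding closed_csubspace_def by auto
qed

text \<open>A minimising sequence for the distance from \<open>x\<close> to \<open>M\<close> is Cauchy by the parallelogram law,
  because midpoints of its members stay in \<open>M\<close>. Its limit is a best approximation, which
  cannot be improved along any \<open>n \<in> M\<close> and thus leaves an orthogonal remainder.\<close>

lemma orthogonal_projection_exists:
  fixes M :: "'a::complex_hilbert_space set"
  assumes M: "closed_csubspace M"
  obtains m where "m \<in> M" "\<And>n. n \<in> M \<Longrightarrow> cinner (x - m) n = 0"
proof -
  define V where "V = (\<lambda>n. (norm (x - n))\<^sup>2) ` M"
  define D where "D = Inf V"
  have "V \<noteq> {}" and bdd: "bdd_below V"
    using closed_csubspaceD(2)[OF M] by (auto simp: V_def intro: bdd_belowI[where m = 0])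
  have D_le: "D \<le> (norm (x - n))\<^sup>2" if "n \<in> M" for n
    unfolding D_def using that bdd by (auto simp: V_def intro: cInf_lower)
  have "\<exists>n\<in>M. (norm (x - n))\<^sup>2 < D + inverse (real (Suc k))" for k
    using \<open>V \<noteq> {}\<close> bdd cInf_less_iff[of V "D + inverse (real (Suc k))"]
    by (auto simp: D_def V_def)
  then obtain s where s: "\<And>k. s k \<in> M"
      and s_less: "\<And>k. (norm (x - s k))\<^sup>2 < D + inverse (real (Suc k))"
    by metis
  have s_dist: "(norm (s i - s j))\<^sup>2 \<le> 2 * inverse (real (Suc i)) + 2 * inverse (real (Suc j))"
    for i j
  proof -
    define h where "h = (1/2) *\<^sub>R (s i + s j)"
    have "h \<in> M"
      using s closed_csubspaceD[OF M] by (simp add: h_def scaleR_scaleC)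
    have "(x - s j) + (x - s i) = 2 *\<^sub>R (x - h)"
      by (simp add: h_def algebra_simps scaleR_2)
    then have "(norm ((x - s j) + (x - s i)))\<^sup>2 = 4 * (norm (x - h))\<^sup>2"
      by (simp add: power_mult_distrib)
    moreover have "(x - s j) - (x - s i) = s i - s j"
      by simp
    ultimately show ?thesis
      using parallelogram_law_cinner[of "x - s j" "x - s i"] D_le[OF \<open>h \<in> M\<close>]
        s_less[of i] s_less[of j] by simp
  qed
  have "Cauchy s"
  proof (rule CauchyI)
    fix e :: real
    assume "0 < e"
    then obtain N where N: "inverse (real (Suc N)) < e\<^sup>2 / 4"
      using reals_Archimedean[of "e\<^sup>2 / 4"] by auto
    have "norm (s i - s j) < e" if "N \<le> i" "N \<le> j" for i j
    proof (rule power2_less_imp_less)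
      have "inverse (real (Suc i)) \<le> inverse (real (Suc N))"
        "inverse (real (Suc j)) \<le> inverse (real (Suc N))"
        using that by auto
      with s_dist[of i j] N show "(norm (s i - s j))\<^sup>2 < e\<^sup>2"
        by linarith
    qed (use \<open>0 < e\<close> in simp)
    then show "\<exists>N. \<forall>i\<ge>N. \<forall>j\<ge>N. norm (s i - s j) < e"
      by blast
  qed
  then obtain m where m: "s \<longlonglongrightarrow> m"
    using Cauchy_convergent convergent_def by blast
  have "m \<in> M"
    using closed_sequentially[OF closed_csubspaceD(1)[OF M] _ m] s by blast
  have "(\<lambda>k. (norm (x - s k))\<^sup>2) \<longlonglongrightarrow> (norm (x - m))\<^sup>2"
    by (intro tendsto_intros m)
  moreover have "(\<lambda>k. D + inverse (real (Suc k))) \<longlonglongrightarrow> D"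
    using tendsto_add[OF tendsto_const LIMSEQ_inverse_real_of_nat, of D] by simp
  ultimately have best: "(norm (x - m))\<^sup>2 \<le> D"
    using s_less by (meson LIMSEQ_le less_imp_le)
  have "cinner (x - m) n = 0" if "n \<in> M" for n
  proof (cases "n = 0")
    case False
    define c where "c = cinner (x - m) n / cinner n n"
    have "m + c *\<^sub>C n \<in> M"
      using \<open>m \<in> M\<close> that closed_csubspaceD[OF M] by blast
    from order_trans[OF best D_le[OF this]]
    have "(norm (x - m))\<^sup>2 \<le> (norm (x - m - c *\<^sub>C n))\<^sup>2"
      by (simp only: diff_diff_add)
    then have "(cmod (cinner (x - m) n))\<^sup>2 / (norm n)\<^sup>2 \<le> 0"
      using norm_diff_component[OF False, of "x - m"] by (simp add: c_def)
    then show ?thesis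
      using False by (simp add: divide_le_0_iff)
  qed simp
  with \<open>m \<in> M\<close> show thesis
    by (rule that)
qed

text \<open>The representing vector of a nonzero functional \<open>f\<close> is a multiple of any vector \<open>e\<close>
  orthogonal to the kernel, since \<open>x - (f x / f e) e\<close> lies in the kernel for every \<open>x\<close>.\<close>

lemma Riesz_representation:
  fixes f :: "'a::complex_hilbert_space \<Rightarrow> complex"
  assumes f: "bounded_clinear f"
  obtains v where "\<And>x. f x = cinner x v"
proof (cases "\<forall>x. f x = 0")
  case True
  then show thesis
    using that[of 0] by simp
next
  case False
  then obtain u where u: "f u \<noteq> 0"
    by blast
  obtain p where p: "f p = 0" and orth: "\<And>n. f n = 0 \<Longrightarrow> cinner (u - p) n = 0"
    using orthogonal_projection_exists[OF closed_csubspace_kernel[OF f], of u] by auto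
  define e where "e = u - p"
  have fe: "f e \<noteq> 0"
    using u p by (simp add: e_def bounded_clinearD[OF f])
  then have ee: "cinner e e \<noteq> 0"
    using bounded_clinearD(5)[OF f] by (auto simp: cinner_self_eq_zero)
  have "f x = cinner x (cnj (f e / cinner e e) *\<^sub>C e)" for x
  proof -
    have "f (x - (f x / f e) *\<^sub>C e) = 0"
      using fe by (simp add: bounded_clinearD[OF f] scaleC_complex_def)
    then have "cinner (x - (f x / f e) *\<^sub>C e) e = 0"
      using orth e_def cinner_zero_commute by metis
    then have "cinner x e = f x / f e * cinner e e"
      by (simp add: cinner_diff_left cinner_scaleC_left)
    then show ?thesis
      using fe ee by (simp add: cinner_scaleC_right)
  qed
  then show thesis
    by (rule that)
qed

lemma cadjoint_eqI:
  assumes "\<And>x y. cinner (T x) y = cinner x (T' y)"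
  shows "cadjoint T = T'"
  unfolding cadjoint_def
proof (rule the_equality)
  fix R
  assume "\<forall>x y. cinner (T x) y = cinner x (R y)"
  with assms show "R = T'"
    by (metis cinner_ext ext)
qed (use assms in blast)

lemma cinner_cadjoint:
  fixes T :: "'a::complex_hilbert_space \<Rightarrow> 'b::complex_hilbert_space"
  assumes T: "bounded_clinear T"
  shows "cinner (T x) y = cinner x (cadjoint T y)"
proof -
  have "\<exists>v. \<forall>x. cinner (T x) y = cinner x v" for y
  proof -
    have "bounded_clinear (\<lambda>x. cinner (T x) y)"
      using bounded_clinear_compose[OF bounded_clinear_cinner_left T] by (simp add: o_def)
    then show ?thesis
      using Riesz_representation by metis
  qed
  then obtain T' where "\<And>x y. cinner (T x) y = cinner x (T' y)"
    by metis
  with cadjoint_eqI show ?thesis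
    by metis
qed

section \<open>Existence and uniqueness of the Moore-Penrose inverse\<close>

text \<open>The products \<open>T X\<close> and \<open>T Y\<close> are self-adjoint idempotents with the same range, hence
  equal, and likewise \<open>X T\<close> and \<open>Y T\<close> with the same kernel. Then \<open>X = X T X = Y T Y = Y\<close>.\<close>

lemma mp_inverse_unique:
  assumes T: "bounded_clinear T" and X: "is_mp_inverse T X" and Y: "is_mp_inverse T Y"
  shows "X = Y"
proof -
  have TT: "T (X (T x)) = T x" "T (Y (T x)) = T x"
      "X (T (X x)) = X x" "Y (T (Y x)) = Y x" for x
    using X Y unfolding is_mp_inverse_def by (metis comp_apply)+
  have "bounded_clinear X" "bounded_clinear Y"
    using X Y unfolding is_mp_inverse_def by auto
  then have bdd: "bounded_clinear (T \<circ> X)" "bounded_clinear (T \<circ> Y)"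
      "bounded_clinear (X \<circ> T)" "bounded_clinear (Y \<circ> T)"
    using T by (auto intro: bounded_clinear_compose)
  have adj: "cinner (T (X x)) y = cinner x (T (X y))" "cinner (T (Y x)) y = cinner x (T (Y y))"
      "cinner (X (T x)) y = cinner x (X (T y))" "cinner (Y (T x)) y = cinner x (Y (T y))" for x y
    using X Y cinner_cadjoint[OF bdd(1), of x y] cinner_cadjoint[OF bdd(2), of x y]
      cinner_cadjoint[OF bdd(3), of x y] cinner_cadjoint[OF bdd(4), of x y]
    unfolding is_mp_inverse_def by (metis comp_apply)+
  have TX_TY: "T (X y) = T (Y y)" for y
  proof (rule cinner_ext)
    fix z
    have "cinner z (T (X y)) = cinner (T (Y (T (X z)))) y"
      by (simp add: TT adj)
    also have "\<dots> = cinner z (T (Y y))"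
      by (metis TT(1) adj(1,2))
    finally show "cinner z (T (X y)) = cinner z (T (Y y))" .
  qed
  have XT_YT: "X (T y) = Y (T y)" for y
  proof (rule cinner_ext)
    fix z
    have "cinner z (X (T y)) = cinner (X (T z)) (Y (T y))"
      by (metis TT(2) adj(3))
    also have "\<dots> = cinner z (Y (T y))"
      by (metis TT(1) adj(4))
    finally show "cinner z (X (T y)) = cinner z (Y (T y))" .
  qed
  have "X y = Y y" for y
    by (metis TT(3,4) TX_TY XT_YT)
  then show ?thesis
    by (rule ext)
qed

text \<open>By Baire's theorem one of the closed sets \<open>{x. \<forall>i. norm (f i x) \<le> k}\<close>, which cover
  the space, contains a ball; differences of its points bound every \<open>f i\<close> near the origin.\<close>

lemma uniform_boundedness:
  fixes f :: "'i \<Rightarrow> 'a::banach \<Rightarrow> 'b::real_normed_vector"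
  assumes f: "\<And>i. bounded_linear (f i)" and pointwise: "\<And>x. \<exists>K. \<forall>i. norm (f i x) \<le> K"
  obtains K where "\<And>i x. norm (f i x) \<le> norm x * K"
proof -
  define F where "F k = {x. \<forall>i. norm (f i x) \<le> real k}" for k
  have "closed (F k)" for k
    unfolding F_def using f
    by (intro closed_Collect_all closed_Collect_le continuous_intros linear_continuous_on)
  moreover have "(\<Union>k. F k) = UNIV"
    using pointwise unfolding F_def by (auto, meson order_trans real_arch_simple)
  ultimately have "\<exists>k. interior (F k) \<noteq> {}"
    using Baire_category_alt[of euclidean "range F"] completely_metrizable_space_euclidean
    by auto
  then obtain k a r where "0 < r" and ball: "ball a r \<subseteq> F k"
    by (meson all_not_in_conv mem_interior)
  have near0: "norm (f i x) \<le> 2 * real k" if "norm x < r" for i x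
  proof -
    have "a + x \<in> F k" "a \<in> F k"
      using ball that \<open>0 < r\<close> by (auto simp: dist_norm)
    then have "norm (f i (a + x)) \<le> real k" "norm (f i a) \<le> real k"
      by (auto simp: F_def)
    moreover have "f i x = f i (a + x) - f i a"
      using f by (simp add: bounded_linear.linear linear_add)
    ultimately show ?thesis
      using norm_triangle_ineq4[of "f i (a + x)" "f i a"] by simp
  qed
  have "norm (f i x) \<le> norm x * (4 * real k / r)" for i x
  proof (cases "x = 0")
    case True
    then show ?thesis
      using f by (simp add: bounded_linear.linear linear_0)
  next
    case False
    define t where "t = r / (2 * norm x)"
    have "0 < t"
      using False \<open>0 < r\<close> by (simp add: t_def)
    have "norm (t *\<^sub>R x) < r"
      using False \<open>0 < r\<close> by (simp add: t_def)
    from near0[OF this, of i] have "t * norm (f i x) \<le> 2 * real k"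
      using f \<open>0 < t\<close> by (simp add: bounded_linear.linear linear_scale)
    then show ?thesis
      using False \<open>0 < r\<close> by (simp add: t_def field_simps)
  qed
  then show thesis
    by (rule that)
qed

text \<open>Weak boundedness says that the functionals sending \<open>z\<close> to the inner product of \<open>z\<close> and
  \<open>X y\<close>, scaled by \<open>1 / norm y\<close>, are pointwise bounded in \<open>z\<close>; hence they are uniformly
  bounded, and the norms of these functionals are \<open>norm (X y) / norm y\<close>.\<close>

lemma bounded_clinear_if_weakly_bounded:
  fixes X :: "'a::complex_hilbert_space \<Rightarrow> 'b::complex_hilbert_space"
  assumes add: "\<And>x y. X (x + y) = X x + X y" and scale: "\<And>c x. X (c *\<^sub>C x) = c *\<^sub>C X x"
    and weak: "\<And>z. \<exists>K. \<forall>y. cmod (cinner z (X y)) \<le> norm y * K"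
  shows "bounded_clinear X"
proof -
  define f where "f y z = inverse (norm y) *\<^sub>R cinner z (X y)" for y z
  have X0: "X 0 = 0"
    using add[of 0 0] by simp
  have "bounded_linear (f y)" for y
    unfolding f_def using bounded_clinear_cinner_left
    by (intro bounded_linear_const_scaleR) (auto simp: bounded_clinear_def)
  moreover have "\<exists>K. \<forall>y. norm (f y z) \<le> K" for z
  proof -
    obtain K where K: "\<And>y. cmod (cinner z (X y)) \<le> norm y * K"
      using weak by blast
    have "norm (f y z) \<le> \<bar>K\<bar>" for y
    proof (cases "y = 0")
      case False
      then have "norm (f y z) \<le> K"
        using K[of y] by (simp add: f_def divide_simps mult.commute)
      then show ?thesis
        by simp
    qed (simp add: f_def)
    then show ?thesis
      by blast
  qed
  ultimately obtain K where K: "\<And>y z. norm (f y z) \<le> norm z * K"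
    using uniform_boundedness by blast
  have "norm (X y) \<le> norm y * \<bar>K\<bar>" for y
  proof (cases "X y = 0 \<or> y = 0")
    case True
    then show ?thesis
      using X0 by auto
  next
    case False
    \<comment> \<open>Testing \<open>f y\<close> on the vector \<open>X y\<close> itself recovers its norm.\<close>
    have "norm (f y (X y)) = inverse (norm y) * (norm (X y))\<^sup>2"
      unfolding f_def cinner_self by (simp only: norm_scaleR norm_of_real) simp
    with K[of y "X y"] have "inverse (norm y) * (norm (X y) * norm (X y)) \<le> norm (X y) * K"
      by (simp add: power2_eq_square)
    then have "norm (X y) * (inverse (norm y) * norm (X y)) \<le> norm (X y) * K"
      by (simp add: mult.left_commute)
    then have "inverse (norm y) * norm (X y) \<le> K"
      using False by (simp add: mult_le_cancel_left)
    then have "inverse (norm y) * norm (X y) \<le> \<bar>K\<bar>"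
      by simp
    then show ?thesis
      using False by (simp add: field_simps)
  qed
  then show ?thesis
    using add scale by (intro bounded_clinearI[where K = "\<bar>K\<bar>"])
qed

lemma orthogonal_projection_self_adjoint:
  assumes mem: "\<And>x. P x \<in> M" and orth: "\<And>x n. n \<in> M \<Longrightarrow> cinner (x - P x) n = 0"
  shows "P = cadjoint P"
proof (rule sym, rule cadjoint_eqI)
  fix x y
  have "cinner (x - P x) (P y) = 0" "cinner (y - P y) (P x) = 0"
    using mem orth by auto
  then have "cinner x (P y) = cinner (P x) (P y)" "cinner (P x) y = cinner (P x) (P y)"
    using cinner_zero_commute[of "y - P y" "P x"]
    by (auto simp: cinner_diff_left cinner_diff_right)
  then show "cinner (P x) y = cinner x (P y)"
    by simp
qed

text \<open>Let \<open>M\<close> be the common range of \<open>T\<close> and its adjoint. The kernel of \<open>T\<close> is the orthogonal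
  complement of \<open>M\<close>, so \<open>T\<close> restricts to a bijection of \<open>M\<close>, and inverting \<open>T\<close> on \<open>M\<close> after projecting onto \<open>M\<close>
  gives the Moore-Penrose inverse \<open>X\<close>. It is continuous because every \<open>z\<close> equals
  the adjoint applied to some \<open>w\<close>, up to a vector orthogonal to \<open>M\<close>, so the inner product of \<open>X y\<close>
  and \<open>z\<close> is that of the projection of \<open>y\<close> and \<open>w\<close>; thus \<open>X\<close> is weakly bounded,
  and a weakly bounded linear map is bounded.\<close>

lemma EP_operator_has_mp_inverse:
  fixes T :: "'a::complex_hilbert_space \<Rightarrow> 'a"
  assumes "EP_operator T"
  obtains X where "is_mp_inverse T X"
proof -
  define M where "M = range T"
  have T: "bounded_clinear T" and M_adj: "M = range (cadjoint T)"
    using assms unfolding EP_operator_def M_def by auto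
  have M: "closed_csubspace M"
    using assms closed_csubspace_range unfolding EP_operator_def M_def by blast
  note T_lin = bounded_clinearD[OF T] and M_clos = closed_csubspaceD[OF M]
  have kernel: "T x = 0 \<longleftrightarrow> (\<forall>n\<in>M. cinner x n = 0)" for x
  proof
    assume "\<forall>n\<in>M. cinner x n = 0"
    then have "cinner x (cadjoint T (T x)) = 0"
      unfolding M_adj by blast
    then show "T x = 0"
      by (metis cinner_cadjoint[OF T] cinner_self_eq_zero)
  next
    assume "T x = 0"
    then show "\<forall>n\<in>M. cinner x n = 0"
      unfolding M_adj by (metis cinner_cadjoint[OF T] cinner_zero_left rangeE)
  qed
  have TM: "T x \<in> M" for x
    by (simp add: M_def)
  have T_inj: "u = v" if "u \<in> M" "v \<in> M" "T u = T v" for u v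
  proof -
    have "u - v \<in> M" "T (u - v) = 0"
      using that M_clos T_lin by auto
    then show ?thesis
      using kernel cinner_self_eq_zero by (metis eq_iff_diff_eq_0)
  qed
  have "\<exists>u\<in>M. \<forall>n\<in>M. cinner (y - T u) n = 0" for y
  proof -
    obtain m where "m \<in> M" and m: "\<And>n. n \<in> M \<Longrightarrow> cinner (y - m) n = 0"
      using orthogonal_projection_exists[OF M] by blast
    then obtain v where v: "m = T v"
      unfolding M_def by blast
    obtain u where "u \<in> M" "\<And>n. n \<in> M \<Longrightarrow> cinner (v - u) n = 0"
      using orthogonal_projection_exists[OF M] by blast
    then have "T u = m"
      using kernel[of "v - u"] T_lin v by simp
    with \<open>u \<in> M\<close> m show ?thesis
      by blast
  qed
  then obtain X where XM: "\<And>y. X y \<in> M"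
      and X_orth: "\<And>y n. n \<in> M \<Longrightarrow> cinner (y - T (X y)) n = 0"
    by metis
  have X_eqI: "X y = u" if "u \<in> M" "\<And>n. n \<in> M \<Longrightarrow> cinner (y - T u) n = 0" for y u
  proof -
    have "cinner (T (X y) - T u) n = 0" if "n \<in> M" for n
      using X_orth[OF that, of y] \<open>\<And>n. n \<in> M \<Longrightarrow> cinner (y - T u) n = 0\<close>[OF that]
      by (simp add: cinner_diff_left)
    moreover have "T (X y) - T u \<in> M"
      using TM M_clos by blast
    ultimately have "T (X y) = T u"
      using cinner_self_eq_zero by (metis eq_iff_diff_eq_0)
    then show ?thesis
      using T_inj XM that(1) by blast
  qed
  have X_add: "X (y + z) = X y + X z" for y z
  proof (rule X_eqI)
    show "cinner (y + z - T (X y + X z)) n = 0" if "n \<in> M" for n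
      using X_orth[OF that, of y] X_orth[OF that, of z]
      by (simp add: T_lin cinner_diff_left cinner_add_left)
  qed (use XM M_clos in blast)
  have X_scale: "X (c *\<^sub>C y) = c *\<^sub>C X y" for c y
  proof (rule X_eqI)
    show "cinner (c *\<^sub>C y - T (c *\<^sub>C X y)) n = 0" if "n \<in> M" for n
      using X_orth[OF that, of y] by (simp add: T_lin cinner_diff_left cinner_scaleC_left)
  qed (use XM M_clos in blast)
  have TX_le: "norm (T (X y)) \<le> norm y" for y
  proof -
    have "(norm (y - T (X y) + T (X y)))\<^sup>2 = (norm (y - T (X y)))\<^sup>2 + (norm (T (X y)))\<^sup>2"
      using X_orth[OF TM] by (rule norm_add_orthogonal)
    then have "(norm (T (X y)))\<^sup>2 \<le> (norm y)\<^sup>2"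
      by simp
    then show ?thesis
      by (rule power2_le_imp_le) simp
  qed
  have "\<exists>K. \<forall>y. cmod (cinner z (X y)) \<le> norm y * K" for z
  proof -
    obtain m where "m \<in> M" and m: "\<And>n. n \<in> M \<Longrightarrow> cinner (z - m) n = 0"
      using orthogonal_projection_exists[OF M] by blast
    then obtain w where w: "m = cadjoint T w"
      unfolding M_adj by blast
    have "cmod (cinner z (X y)) \<le> norm y * norm w" for y
    proof -
      have "cinner z (X y) = cinner m (X y)"
        using m[OF XM, of y] by (simp add: cinner_diff_left)
      also have "\<dots> = cnj (cinner (T (X y)) w)"
        unfolding w cinner_cadjoint[OF T] by (rule cinner_commute)
      finally have "cmod (cinner z (X y)) \<le> norm (T (X y)) * norm w"
        by (simp add: cinner_Cauchy_Schwarz)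
      also have "\<dots> \<le> norm y * norm w"
        by (intro mult_right_mono TX_le) simp
      finally show ?thesis .
    qed
    then show ?thesis
      by blast
  qed
  then have X: "bounded_clinear X"
    using X_add X_scale by (rule bounded_clinear_if_weakly_bounded[rotated 2])
  have X_T_eq: "X (T u) = u" if "u \<in> M" for u
    using that by (intro X_eqI) auto
  have TXT: "T (X (T x)) = T x" for x
  proof -
    have "T x - T (X (T x)) \<in> M"
      using TM M_clos by blast
    then show ?thesis
      using X_orth[of _ "T x"] cinner_self_eq_zero by (metis eq_iff_diff_eq_0)
  qed
  have "T \<circ> X = cadjoint (T \<circ> X)"
    by (rule orthogonal_projection_self_adjoint[where M = M]) (auto simp: TM X_orth)
  moreover have "X \<circ> T = cadjoint (X \<circ> T)"
  proof (rule orthogonal_projection_self_adjoint[where M = M])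
    show "cinner (x - (X \<circ> T) x) n = 0" if "n \<in> M" for x n
      using kernel[of "x - X (T x)"] TXT that by (simp add: T_lin)
  qed (simp add: XM)
  moreover have "T \<circ> X \<circ> T = T" "X \<circ> T \<circ> X = X"
    using TXT X_T_eq XM by (simp_all add: fun_eq_iff)
  ultimately have "is_mp_inverse T X"
    unfolding is_mp_inverse_def using X by blast
  then show thesis
    by (rule that)
qed

lemma EP_operator_mp_inverse:
  assumes "EP_operator T"
  shows "is_mp_inverse T (mp_inverse T)"
proof -
  obtain X where X: "is_mp_inverse T X"
    using EP_operator_has_mp_inverse[OF assms] .
  moreover have "Y = X" if "is_mp_inverse T Y" for Y
    using assms that X by (intro mp_inverse_unique[of T]) (auto simp: EP_operator_def)
  ultimately show ?thesis
    unfolding mp_inverse_def by (rule theI[where P = "is_mp_inverse T"])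
qed

section \<open>The intertwining relation for adjoints\<close>

text \<open>The idempotent \<open>T T\<^sup>\<dagger>\<close> fixes the range of \<open>T\<close>, which for an EP operator is also the
  range of the adjoint.\<close>

lemma EP_operator_mp_inverse_cadjoint:
  assumes "EP_operator T"
  shows "T (mp_inverse T (cadjoint T x)) = cadjoint T x"
proof -
  have "cadjoint T x \<in> range T"
    using assms unfolding EP_operator_def by blast
  then obtain u where "cadjoint T x = T u"
    by blast
  moreover have "T (mp_inverse T (T u)) = T u"
    using EP_operator_mp_inverse[OF assms] unfolding is_mp_inverse_def by (metis comp_apply)
  ultimately show ?thesis
    by simp
qed

theorem theorem3p13:
  fixes T S A :: "'h::complex_hilbert_space \<Rightarrow> 'h"
  assumes "EP_operator T" and "EP_operator S"
    and "bounded_clinear A"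
    and "A \<circ> T = S \<circ> A"
    and "A \<circ> mp_inverse T \<circ> cadjoint T = mp_inverse S \<circ> cadjoint S \<circ> A"
  shows "A \<circ> cadjoint T = cadjoint S \<circ> A"
proof
  fix x
  have "A (cadjoint T x) = A (T (mp_inverse T (cadjoint T x)))"
    by (simp add: EP_operator_mp_inverse_cadjoint[OF assms(1)])
  also have "\<dots> = S (A (mp_inverse T (cadjoint T x)))"
    using assms(4) by (metis comp_apply)
  also have "\<dots> = S (mp_inverse S (cadjoint S (A x)))"
    using assms(5) by (metis comp_apply)
  also have "\<dots> = cadjoint S (A x)"
    by (rule EP_operator_mp_inverse_cadjoint[OF assms(2)])
  finally show "(A \<circ> cadjoint T) x = (cadjoint S \<circ> A) x"
    by simp
qed

end
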